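(* Let $G_n$ ($n\ge1$) be the linear crossed polyomino chain with $n$ four-order complete graphs. Then $$\lim_{n\to\infty}\frac{K\!f(G_n)}{W(G_n)}=\frac14.$$
   Context: For $n\geq1$, $G_n$ is the simple graph with vertex set $\{1,\ldots,n+1\}\cup\{1',\ldots,(n+1)'\}$ and edge set consisting of the vertical edges $ii'$ for $1\le i\le n+1$ together with, for each $1\le i\le n$, the edges $i(i+1)$, $i'(i+1)'$, $i(i+1)'$, $i'(i+1)$. $W(G)=\sum_{\{u,v\}}d(u,v)$ is the Wiener index (sum of shortest-path distances over unordered pairs of distinct vertices), and $K\!f(G)=\sum_{\{u,v\}} r_{uv}$ is the Kirchhoff index, where $r_{uv}$ is the effective resistance between $u$ and $v$ when every edge is a unit resistor. *)

theory Defs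
  imports Complex_Main
begin

text \<open>A simple graph is a pair of a finite vertex set and a set of edges, each edge being a
  two-element set of vertices.\<close>

type_synonym 'a sgraph = "'a set \<times> 'a set set"

definition adj :: "'a sgraph \<Rightarrow> ('a \<times> 'a) set" where
  "adj G = {(u, v). u \<in> fst G \<and> v \<in> fst G \<and> u \<noteq> v \<and> {u, v} \<in> snd G}"

text \<open>A pair \<open>(u, v)\<close> lies in \<open>adj G ^^ k\<close> iff there is a walk of length \<open>k\<close> from \<open>u\<close> to \<open>v\<close>.
  The value is meaningful only if \<open>u\<close> and \<open>v\<close> are in the same component.\<close>

definition graph_dist :: "'a sgraph \<Rightarrow> 'a \<Rightarrow> 'a \<Rightarrow> nat" where
  "graph_dist G u v = (LEAST k. (u, v) \<in> adj G ^^ k)"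

text \<open>Every edge is a unit resistor, so by Ohm's law the current from \<open>x\<close> to a neighbour \<open>y\<close> is
  \<open>p x - p y\<close>. Kirchhoff's current law: the net current leaving \<open>x\<close> through the
  edges equals the external current fed in at \<open>x\<close>, where one unit enters at \<open>u\<close>
  and leaves at \<open>v\<close>.\<close>

definition unit_flow_potential :: "'a sgraph \<Rightarrow> 'a \<Rightarrow> 'a \<Rightarrow> ('a \<Rightarrow> real) \<Rightarrow> bool" where
  "unit_flow_potential G u v p \<longleftrightarrow>
     (\<forall>x \<in> fst G. (\<Sum>y \<in> {y. (x, y) \<in> adj G}. p x - p y)
        = (if x = u then 1 else 0) - (if x = v then 1 else 0))"

text \<open>In a finite connected graph the potential exists and is unique up to an additive constant,
  so the voltage between \<open>u\<close> and \<open>v\<close> is well defined.\<close>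

definition eff_resistance :: "'a sgraph \<Rightarrow> 'a \<Rightarrow> 'a \<Rightarrow> real" where
  "eff_resistance G u v = (THE r. \<exists>p. unit_flow_potential G u v p \<and> r = p u - p v)"

text \<open>In both indices the sum over ordered pairs counts each unordered pair twice, since
  distance and resistance are symmetric; hence the factor \<open>1/2\<close>.\<close>

definition wiener_index :: "'a sgraph \<Rightarrow> real" where
  "wiener_index G = (\<Sum>u \<in> fst G. \<Sum>v \<in> fst G - {u}. real (graph_dist G u v)) / 2"

definition kirchhoff_index :: "'a sgraph \<Rightarrow> real" where
  "kirchhoff_index G = (\<Sum>u \<in> fst G. \<Sum>v \<in> fst G - {u}. eff_resistance G u v) / 2"

text \<open>The vertex \<open>i\<close> is encoded as \<open>(i, False)\<close> and the vertex \<open>i'\<close> as \<open>(i, True)\<close>.\<close>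

definition crossed_chain :: "nat \<Rightarrow> (nat \<times> bool) sgraph" where
  "crossed_chain n =
     ({1..n+1} \<times> UNIV,
      (\<Union>i \<in> {1..n+1}. {{(i, False), (i, True)}}) \<union>
      (\<Union>i \<in> {1..n}. {{(i, False), (i+1, False)}, {(i, True), (i+1, True)},
                     {(i, False), (i+1, True)}, {(i, True), (i+1, False)}}))"

end

theory Submission
  imports Defs "HOL-Real_Asymp.Real_Asymp"
begin

text \<open>
  The function \<open>chain_green\<close> below is a Green's function of the Laplacian of the chain: its image
  is the point mass at \<open>u\<close> minus a term that does not depend on \<open>u\<close>. The difference of two Green's
  functions is therefore a unit flow potential, and it shows that the resistance between vertices
  of the columns \<open>i\<close> and \<open>j\<close> is \<open>\<bar>i - j\<bar> / 4\<close> up to a bounded error. The distance is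
  \<open>\<bar>i - j\<bar>\<close> or \<open>1\<close>, so resistance and a quarter of the distance differ by at most \<open>1 / 4\<close>. Summed
  over all pairs the error is quadratic in \<open>n\<close>, while the Wiener index grows cubically.
\<close>

section \<open>Potentials and effective resistance in a finite graph\<close>

lemma adj_sym: "(x, y) \<in> adj G \<Longrightarrow> (y, x) \<in> adj G"
  by (auto simp: adj_def insert_commute)

text \<open>The Laplacian is a symmetric matrix: expanded over ordered adjacent pairs, both sides
  have the same diagonal part, and reversing every pair exchanges the mixed products.\<close>

lemma laplacian_self_adjoint:
  fixes p q :: "'a \<Rightarrow> real"
  assumes "finite (fst G)"
  shows "(\<Sum>x\<in>fst G. q x * (\<Sum>y \<in> {y. (x, y) \<in> adj G}. p x - p y)) =
         (\<Sum>x\<in>fst G. p x * (\<Sum>y \<in> {y. (x, y) \<in> adj G}. q x - q y))"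
proof -
  have fin: "finite {y. (x, y) \<in> adj G}" for x
    by (rule finite_subset[OF _ assms]) (auto simp: adj_def)
  have adj: "Sigma (fst G) (\<lambda>x. {y. (x, y) \<in> adj G}) = adj G"
    by (auto simp: adj_def)
  have edges: "(\<Sum>x\<in>fst G. g x * (\<Sum>y \<in> {y. (x, y) \<in> adj G}. f x - f y)) =
      (\<Sum>(x, y)\<in>adj G. g x * f x) - (\<Sum>(x, y)\<in>adj G. g x * f y)" for f g :: "'a \<Rightarrow> real"
  proof -
    have "(\<Sum>x\<in>fst G. g x * (\<Sum>y \<in> {y. (x, y) \<in> adj G}. f x - f y)) =
        (\<Sum>(x, y)\<in>Sigma (fst G) (\<lambda>x. {y. (x, y) \<in> adj G}). g x * (f x - f y))"
      using assms fin by (simp add: sum_distrib_left sum.Sigma)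
    then show ?thesis
      by (simp add: adj case_prod_unfold right_diff_distrib sum_subtractf)
  qed
  have swap: "(\<Sum>(x, y)\<in>adj G. q x * p y) = (\<Sum>(x, y)\<in>adj G. p x * q y)"
    by (rule sum.reindex_bij_witness[of _ prod.swap prod.swap]) (auto intro: adj_sym)
  show ?thesis
    unfolding edges swap by (simp add: mult.commute)
qed

text \<open>Pairing the Laplacian of a unit flow potential with any function \<open>g\<close> gives
  \<open>g u - g v\<close>; apply this to \<open>p\<close> against \<open>q\<close> and to
  \<open>q\<close> against \<open>p\<close>. So any single potential determines the
  resistance.\<close>

lemma unit_flow_voltage_unique:
  assumes "finite (fst G)" "u \<in> fst G" "v \<in> fst G"
    and p: "unit_flow_potential G u v p" and q: "unit_flow_potential G u v q"
  shows "p u - p v = q u - q v"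
proof -
  have voltage: "(\<Sum>x\<in>fst G. g x * (\<Sum>y \<in> {y. (x, y) \<in> adj G}. f x - f y)) = g u - g v"
    if "unit_flow_potential G u v f" for f g
  proof -
    have "(\<Sum>x\<in>fst G. g x * (\<Sum>y \<in> {y. (x, y) \<in> adj G}. f x - f y)) =
        (\<Sum>x\<in>fst G. (if x = u then g x else 0) - (if x = v then g x else 0))"
      using that by (intro sum.cong) (auto simp: unit_flow_potential_def)
    also have "\<dots> = g u - g v"
      using assms(1-3) by (simp add: sum_subtractf)
    finally show ?thesis .
  qed
  show ?thesis
    using laplacian_self_adjoint[OF assms(1), of q p] voltage[OF p, of q] voltage[OF q, of p]
    by simp
qed

lemma eff_resistance_eq:
  assumes "finite (fst G)" "u \<in> fst G" "v \<in> fst G" "unit_flow_potential G u v p"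
  shows "eff_resistance G u v = p u - p v"
  unfolding eff_resistance_def
  using assms unit_flow_voltage_unique[OF assms(1-3)] by (intro the_equality) blast+

section \<open>Adjacency and the Green's function of the chain\<close>

lemma vertices_crossed_chain: "fst (crossed_chain n) = {1..n+1} \<times> UNIV"
  by (simp add: crossed_chain_def)

lemma adj_crossed_chain:
  "((i, b), (j, c)) \<in> adj (crossed_chain n) \<longleftrightarrow>
     i \<in> {1..n+1} \<and> j \<in> {1..n+1} \<and> (i = j \<and> b \<noteq> c \<or> j = Suc i \<or> i = Suc j)"
  by (cases b; cases c) (auto simp: adj_def crossed_chain_def doubleton_eq_iff)

lemma sum_neighbours_crossed_chain:
  fixes h :: "nat \<times> bool \<Rightarrow> real"
  assumes "k \<in> {1..n+1}"
  shows "(\<Sum>y \<in> {y. ((k, e), y) \<in> adj (crossed_chain n)}. h y) =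
    h (k, \<not> e) + (if k = 1 then 0 else h (k - 1, False) + h (k - 1, True))
      + (if k = n + 1 then 0 else h (k + 1, False) + h (k + 1, True))"
proof -
  let ?L = "if k = 1 then {} else {(k - 1, False), (k - 1, True)}"
  let ?R = "if k = n + 1 then {} else {(k + 1, False), (k + 1, True)}"
  have "{y. ((k, e), y) \<in> adj (crossed_chain n)} = {(k, \<not> e)} \<union> ?L \<union> ?R"
    using assms by (auto simp: adj_crossed_chain split: if_splits)
  also have "sum h \<dots> = sum h ({(k, \<not> e)} \<union> ?L) + sum h ?R"
    using assms by (intro sum.union_disjoint) auto
  also have "sum h ({(k, \<not> e)} \<union> ?L) = sum h {(k, \<not> e)} + sum h ?L"
    using assms by (intro sum.union_disjoint) auto
  finally show ?thesis
    by simp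
qed

text \<open>The Laplacian multiplies a function that is odd under the swap of \<open>k\<close> and \<open>k'\<close> by one more
  than the degree, that is by \<open>4\<close> in the end columns and by \<open>6\<close> elsewhere. Half the reciprocal is
  the weight \<open>1 / 8\<close> or \<open>1 / 12\<close>.\<close>

definition chain_green :: "nat \<Rightarrow> nat \<times> bool \<Rightarrow> nat \<times> bool \<Rightarrow> real" where
  "chain_green n u x =
     (if fst x = fst u
      then (if x = u then 1 else - 1) * (if fst u = 1 \<or> fst u = n + 1 then 1 / 8 else 1 / 12)
      else 0) - \<bar>real (fst x) - real (fst u)\<bar> / 8"

text \<open>Every vertex is joined to both vertices of an adjacent column. Hence the odd term
  cancels outside the column of \<open>u\<close>, leaving 1/2 at \<open>u\<close> and -1/2 at its
  partner. The distance term has slope 1/8 in absolute value, so its Laplacian is 1/2 on both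
  vertices of that column, minus 1/4 on the end columns.\<close>

lemma laplacian_chain_green:
  assumes "n \<ge> 1" "u \<in> fst (crossed_chain n)" "x \<in> fst (crossed_chain n)"
  shows "(\<Sum>y \<in> {y. (x, y) \<in> adj (crossed_chain n)}. chain_green n u x - chain_green n u y) =
    (if x = u then 1 else 0) - (if fst x = 1 \<or> fst x = n + 1 then 1 / 4 else 0)"
proof -
  obtain i b k e where [simp]: "u = (i, b)" "x = (k, e)"
    by (cases u; cases x)
  have k: "k \<in> {1..n+1}" and i: "i \<in> {1..n+1}"
    using assms by (auto simp: vertices_crossed_chain)
  note expand = sum_neighbours_crossed_chain[OF k] sum_neighbours_crossed_chain[OF i] chain_green_def
    of_nat_diff abs_if field_simps
  consider "k < i" | "k = i" | "k > i" by linarith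
  then show ?thesis
  proof cases
    case 1
    with k i \<open>n \<ge> 1\<close> show ?thesis by (auto simp: expand; linarith)
  next
    case 2
    with k i \<open>n \<ge> 1\<close> show ?thesis by (auto simp: expand)
  next
    case 3
    with k i \<open>n \<ge> 1\<close> show ?thesis by (auto simp: expand; linarith)
  qed
qed

lemma unit_flow_potential_chain_green:
  assumes "n \<ge> 1" "u \<in> fst (crossed_chain n)" "v \<in> fst (crossed_chain n)"
  shows "unit_flow_potential (crossed_chain n) u v (\<lambda>x. chain_green n u x - chain_green n v x)"
  unfolding unit_flow_potential_def
proof
  fix x assume x: "x \<in> fst (crossed_chain n)"
  have "(\<Sum>y \<in> {y. (x, y) \<in> adj (crossed_chain n)}.
        (chain_green n u x - chain_green n v x) - (chain_green n u y - chain_green n v y)) =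
      (\<Sum>y \<in> {y. (x, y) \<in> adj (crossed_chain n)}. chain_green n u x - chain_green n u y) -
      (\<Sum>y \<in> {y. (x, y) \<in> adj (crossed_chain n)}. chain_green n v x - chain_green n v y)"
    unfolding sum_subtractf[symmetric] by (intro sum.cong) auto
  then show "(\<Sum>y \<in> {y. (x, y) \<in> adj (crossed_chain n)}.
        (chain_green n u x - chain_green n v x) - (chain_green n u y - chain_green n v y)) =
      (if x = u then 1 else 0) - (if x = v then 1 else 0)"
    using laplacian_chain_green[OF assms(1,2) x] laplacian_chain_green[OF assms(1,3) x] by simp
qed

section \<open>Distances in the chain, compared with resistances\<close>

lemma walk_crossed_chain_columns:
  "(x, y) \<in> adj (crossed_chain n) ^^ k \<Longrightarrow> \<bar>int (fst x) - int (fst y)\<bar> \<le> int k"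
proof (induction k arbitrary: y)
  case (Suc k)
  then obtain z where "(x, z) \<in> adj (crossed_chain n) ^^ k" "(z, y) \<in> adj (crossed_chain n)"
    by auto
  with Suc.IH[of z] show ?case
    by (cases z; cases y) (auto simp: adj_crossed_chain)
qed simp

text \<open>The first edge may already cross to row \<open>c\<close>, and the walk then stays in
  that row. The length is \<open>Suc k\<close> because a walk of length 0 could not change
  rows.\<close>

lemma walk_crossed_chain_up:
  assumes "i \<ge> 1" "i + k + 1 \<le> n + 1"
  shows "((i, b), (i + k + 1, c)) \<in> adj (crossed_chain n) ^^ Suc k"
  using assms(2)
proof (induction k arbitrary: c)
  case 0
  then show ?case using assms(1) by (auto simp: adj_crossed_chain)
next
  case (Suc k)
  have "((i, b), (i + k + 1, c)) \<in> adj (crossed_chain n) ^^ Suc k"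
    using Suc by simp
  moreover have "((i + k + 1, c), (i + Suc k + 1, c)) \<in> adj (crossed_chain n)"
    using assms(1) Suc.prems by (auto simp: adj_crossed_chain)
  ultimately show ?case
    by (rule relpow_Suc_I)
qed

lemma walk_reverse: "(x, y) \<in> adj G ^^ k \<Longrightarrow> (y, x) \<in> adj G ^^ k"
proof (induction k arbitrary: y)
  case (Suc k)
  from Suc.prems obtain z where "(x, z) \<in> adj G ^^ k" "(z, y) \<in> adj G"
    by (rule relpow_Suc_E)
  with Suc.IH show ?case
    by (blast intro: relpow_Suc_I2 adj_sym)
qed simp

lemma graph_dist_crossed_chain:
  assumes "u \<in> fst (crossed_chain n)" "v \<in> fst (crossed_chain n)" "u \<noteq> v"
  shows "real (graph_dist (crossed_chain n) u v) =
    (if fst u = fst v then 1 else \<bar>real (fst u) - real (fst v)\<bar>)"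
proof -
  obtain i b j c where [simp]: "u = (i, b)" "v = (j, c)"
    by (cases u; cases v)
  have ij: "i \<in> {1..n+1}" "j \<in> {1..n+1}"
    using assms by (auto simp: vertices_crossed_chain)
  let ?A = "adj (crossed_chain n)"
  have up: "((k, d), (l, e)) \<in> ?A ^^ (l - k)" if "1 \<le> k" "k < l" "l \<le> n + 1" for k l d e
    using walk_crossed_chain_up[of k "l - k - 1" n d e] that by (simp add: Suc_diff_Suc)
  show ?thesis
  proof (cases "i = j")
    case True
    with assms ij have "(u, v) \<in> ?A ^^ 1"
      by (auto simp: adj_crossed_chain)
    moreover have "(u, v) \<in> ?A ^^ k \<Longrightarrow> 1 \<le> k" for k
      using assms(3) by (cases k) auto
    ultimately have "graph_dist (crossed_chain n) u v = 1"
      unfolding graph_dist_def by (rule Least_equality)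
    with True show ?thesis by simp
  next
    case False
    \<comment> \<open>The column gap is attained by a monotone walk, and no walk is shorter since an
      edge changes the column by at most one.\<close>
    let ?d = "nat \<bar>int i - int j\<bar>"
    have "(u, v) \<in> ?A ^^ ?d"
    proof (cases "i < j")
      case True
      then have "?d = j - i" by simp
      with True up[of i j b c] ij show ?thesis by simp
    next
      case False
      with \<open>i \<noteq> j\<close> have "j < i" "?d = i - j" by simp_all
      with walk_reverse[OF up[of j i c b]] ij show ?thesis by simp
    qed
    moreover have "(u, v) \<in> ?A ^^ k \<Longrightarrow> ?d \<le> k" for k
      using walk_crossed_chain_columns[of u v k n] by simp
    ultimately have "graph_dist (crossed_chain n) u v = ?d"
      unfolding graph_dist_def by (rule Least_equality)
    with False show ?thesis by simp
  qed
qed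

text \<open>In different columns the error is the sum of the weights of \<open>u\<close> and
  \<open>v\<close>, at most 1/8 + 1/8. In one column the resistance is four times the weight, 1/2 or
  1/3, against 1/4.\<close>

lemma resistance_near_quarter_distance:
  assumes "n \<ge> 1" "u \<in> fst (crossed_chain n)" "v \<in> fst (crossed_chain n)" "u \<noteq> v"
  shows "\<bar>eff_resistance (crossed_chain n) u v - real (graph_dist (crossed_chain n) u v) / 4\<bar> \<le> 1 / 4"
proof -
  have "eff_resistance (crossed_chain n) u v =
      (chain_green n u u - chain_green n v u) - (chain_green n u v - chain_green n v v)"
    by (rule eff_resistance_eq[OF _ assms(2,3) unit_flow_potential_chain_green[OF assms(1-3)]])
      (simp add: vertices_crossed_chain)
  then show ?thesis
    using assms(4) unfolding graph_dist_crossed_chain[OF assms(2-4)]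
    by (auto simp: chain_green_def abs_minus_commute)
qed

section \<open>Summation over all pairs and the limit\<close>

lemma sum_abs_diff_eq: "(\<Sum>i=1..m. \<Sum>j=1..m. \<bar>real i - real j\<bar>) = (real m ^ 3 - real m) / 3"
proof (induction m)
  case (Suc m)
  \<comment> \<open>Passing from \<open>m\<close> to \<open>Suc m\<close> adds one row and one
    column with this sum each, and a zero diagonal entry.\<close>
  have "(\<Sum>i=1..m. \<bar>real i - real (Suc m)\<bar>) = real m * (real m + 1) / 2"
  proof -
    have "(\<Sum>i=1..m. \<bar>real i - real (Suc m)\<bar>) = (\<Sum>i=1..m. real (Suc m) - real i)"
      by (intro sum.cong) auto
    also have "\<dots> = real m * (real m + 1) - (\<Sum>i=1..m. real i)"
      by (simp add: sum_subtractf algebra_simps)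
    also have "(\<Sum>i=1..m. real i) = real m * (real m + 1) / 2"
      by (induction m) (auto simp: field_simps)
    finally show ?thesis by simp
  qed
  moreover from this have "(\<Sum>j=1..m. \<bar>real (Suc m) - real j\<bar>) = real m * (real m + 1) / 2"
    by (simp add: abs_minus_commute)
  ultimately show ?case
    using Suc by (simp add: sum.distrib) (simp add: field_simps power3_eq_cube)
qed simp

lemma wiener_index_crossed_chain_ge:
  "wiener_index (crossed_chain n) \<ge> 2 * (real (n + 1) ^ 3 - real (n + 1)) / 3"
proof -
  let ?V = "fst (crossed_chain n)"
  have columns: "(\<Sum>u\<in>?V. f (fst u)) = 2 * (\<Sum>i=1..n+1. f i)" for f :: "nat \<Rightarrow> real"
  proof -
    have "(\<Sum>u\<in>?V. f (fst u)) = (\<Sum>i=1..n+1. \<Sum>b\<in>(UNIV :: bool set). f i)"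
      unfolding vertices_crossed_chain sum.cartesian_product by (simp add: case_prod_unfold)
    then show ?thesis
      by (simp add: sum_distrib_left del: sum.cl_ivl_Suc)
  qed
  let ?S = "\<lambda>i. \<Sum>j=1..n+1. \<bar>real i - real j\<bar>"
  have "4 * (\<Sum>i=1..n+1. ?S i) = 2 * (\<Sum>i=1..n+1. 2 * ?S i)"
    by (simp only: sum_distrib_left[symmetric])
  also have "\<dots> = (\<Sum>u\<in>?V. 2 * ?S (fst u))"
    by (rule columns[symmetric])
  also have "\<dots> = (\<Sum>u\<in>?V. \<Sum>v\<in>?V. \<bar>real (fst u) - real (fst v)\<bar>)"
    by (intro sum.cong refl columns[symmetric])
  also have "\<dots> = (\<Sum>u\<in>?V. \<Sum>v\<in>?V - {u}. \<bar>real (fst u) - real (fst v)\<bar>)"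
    by (intro sum.cong refl sum.mono_neutral_right) (auto simp: vertices_crossed_chain)
  \<comment> \<open>Only the two vertices of one column make this an inequality: their column gap is
    0, their distance 1.\<close>
  also have "\<dots> \<le> (\<Sum>u\<in>?V. \<Sum>v\<in>?V - {u}. real (graph_dist (crossed_chain n) u v))"
    by (intro sum_mono, subst graph_dist_crossed_chain) auto
  also have "\<dots> = 2 * wiener_index (crossed_chain n)"
    by (simp add: wiener_index_def)
  finally show ?thesis
    unfolding sum_abs_diff_eq by simp
qed

lemma kirchhoff_index_near_quarter_wiener:
  assumes "n \<ge> 1"
  shows "\<bar>kirchhoff_index (crossed_chain n) - wiener_index (crossed_chain n) / 4\<bar>
    \<le> real (n + 1) ^ 2 / 2"
proof -
  let ?G = "crossed_chain n"
  let ?V = "fst ?G"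
  let ?f = "\<lambda>u v. eff_resistance ?G u v - real (graph_dist ?G u v) / 4"
  have fin: "finite ?V" and card: "card ?V = 2 * (n + 1)"
    by (simp_all add: vertices_crossed_chain card_cartesian_product)
  have "\<bar>\<Sum>u\<in>?V. \<Sum>v\<in>?V - {u}. ?f u v\<bar> \<le> (\<Sum>u\<in>?V. \<Sum>v\<in>?V - {u}. \<bar>?f u v\<bar>)"
    by (rule order_trans[OF sum_abs sum_mono[OF sum_abs]])
  also have "\<dots> \<le> (\<Sum>u\<in>?V. \<Sum>v\<in>?V - {u}. 1 / 4)"
    using assms by (intro sum_mono resistance_near_quarter_distance) auto
  \<comment> \<open>Restoring the diagonal leaves a constant summed over the square of
    \<open>2 * (n + 1)\<close> ordered pairs.\<close>
  also have "\<dots> \<le> (\<Sum>u\<in>?V. \<Sum>v\<in>?V. 1 / 4)"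
    using fin by (intro sum_mono sum_mono2) auto
  also have "\<dots> = real (n + 1) ^ 2"
    by (simp add: card power2_eq_square field_simps)
  finally have "\<bar>\<Sum>u\<in>?V. \<Sum>v\<in>?V - {u}. ?f u v\<bar> \<le> real (n + 1) ^ 2" .
  moreover have "kirchhoff_index ?G - wiener_index ?G / 4 = (\<Sum>u\<in>?V. \<Sum>v\<in>?V - {u}. ?f u v) / 2"
    by (simp add: kirchhoff_index_def wiener_index_def sum_subtractf sum_divide_distrib
        diff_divide_distrib)
  ultimately show ?thesis
    by linarith
qed

theorem theorem3p2:
  "(\<lambda>n. kirchhoff_index (crossed_chain n) / wiener_index (crossed_chain n)) \<longlonglongrightarrow> 1 / 4"
proof -
  let ?K = "\<lambda>n. kirchhoff_index (crossed_chain n)"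
  let ?W = "\<lambda>n. wiener_index (crossed_chain n)"
  let ?c = "\<lambda>n. 2 * (real (n + 1) ^ 3 - real (n + 1)) / 3"
  \<comment> \<open>The quadratic error is divided by the cubic lower bound \<open>?c n\<close> of
    the Wiener index, which is positive once \<open>n + 1 > 1\<close>.\<close>
  have "norm (?K n / ?W n - 1 / 4) \<le> (real (n + 1) ^ 2 / 2) / ?c n" if "n \<ge> 1" for n
  proof -
    have "real (n + 1) ^ 1 < real (n + 1) ^ 3"
      using that by (intro power_strict_increasing) auto
    then have c: "0 < ?c n" by simp
    then have W: "0 < ?W n"
      using wiener_index_crossed_chain_ge[of n] by linarith
    then have "?K n / ?W n - 1 / 4 = (?K n - ?W n / 4) / ?W n"
      by (simp add: diff_divide_distrib)
    then have "norm (?K n / ?W n - 1 / 4) = \<bar>?K n - ?W n / 4\<bar> / ?W n"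
      using W by simp
    also have "\<dots> \<le> (real (n + 1) ^ 2 / 2) / ?c n"
      using kirchhoff_index_near_quarter_wiener[OF that] wiener_index_crossed_chain_ge[of n] c
      by (intro frac_le) auto
    finally show ?thesis .
  qed
  then have "\<forall>\<^sub>F n in sequentially.
      norm (?K n / ?W n - 1 / 4) \<le> norm ((real (n + 1) ^ 2 / 2) / ?c n) * 1"
    by (intro eventually_sequentiallyI[of 1])
      (simp only: mult_1_right real_norm_def, rule order_trans[OF _ abs_ge_self])
  moreover have "(\<lambda>n. (real (n + 1) ^ 2 / 2) / ?c n) \<longlonglongrightarrow> 0"
    by real_asymp
  ultimately have "(\<lambda>n. ?K n / ?W n - 1 / 4) \<longlonglongrightarrow> 0"
    by (rule tendsto_0_le[rotated])
  then show ?thesis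
    by (rule LIM_zero_cancel)
qed

end
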